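(* For any connected graph $G$ of order $n\geq 2$, $$\gamma_t(M(G\circ P_2))=2n.$$
   Context: All graphs are finite and simple. The $2$-corona $G\circ P_2$ is the graph of order $3|V(G)|$ obtained from $G$ by attaching to each vertex $v$ of $G$ a path of length $2$ (i.e. two new vertices $a_v,b_v$ with edges $va_v$ and $a_vb_v$), so that these paths are vertex-disjoint. For a graph $H$ with no isolated vertices, a total dominating set of $H$ is a set $S\subseteq V(H)$ such that every vertex of $H$ has at least one neighbor in $S$; $\gamma_t(H)$ is the minimum cardinality of a total dominating set. The middle graph $M(G)$ of a graph $G$ has vertex set $V(G)\cup E(G)$ (disjoint union), and two of its vertices $x,y$ are adjacent exactly when either $x,y\in E(G)$ are edges of $G$ sharing a common endpoint, or $x\in V(G)$, $y\in E(G)$ and $x$ is an endpoint of $y$ (no two elements of $V(G)$ are adjacent in $M(G)$). *)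

theory Defs
  imports Main
begin

text \<open>Undirected graphs without parallel edges; an edge is the set of its endpoints.\<close>

record 'a ugraph =
  verts :: "'a set"
  edges :: "'a set set"

definition simple_graph :: "'a ugraph \<Rightarrow> bool" where
  "simple_graph G \<longleftrightarrow> finite (verts G) \<and>
     (\<forall>e \<in> edges G. \<exists>u \<in> verts G. \<exists>v \<in> verts G. u \<noteq> v \<and> e = {u, v})"

definition adjacent :: "'a ugraph \<Rightarrow> 'a \<Rightarrow> 'a \<Rightarrow> bool" where
  "adjacent G u v \<longleftrightarrow> {u, v} \<in> edges G"

definition connected_graph :: "'a ugraph \<Rightarrow> bool" where
  "connected_graph G \<longleftrightarrow> verts G \<noteq> {} \<and>
     (\<forall>u \<in> verts G. \<forall>v \<in> verts G. (adjacent G)\<^sup>*\<^sup>* u v)"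

datatype 'a corona_vertex = Orig 'a | PathA 'a | PathB 'a

text \<open>\<^term>\<open>PathA v\<close> and \<^term>\<open>PathB v\<close> are the two new vertices of the path attached
  to \<^term>\<open>v\<close>, with \<^term>\<open>PathA v\<close> the one next to \<^term>\<open>v\<close>.\<close>

definition two_corona :: "'a ugraph \<Rightarrow> 'a corona_vertex ugraph" where
  "two_corona G = \<lparr>
     verts = Orig ` verts G \<union> PathA ` verts G \<union> PathB ` verts G,
     edges = {{Orig u, Orig v} | u v. {u, v} \<in> edges G}
           \<union> {{Orig v, PathA v} | v. v \<in> verts G}
           \<union> {{PathA v, PathB v} | v. v \<in> verts G} \<rparr>"

definition middle_graph :: "'a ugraph \<Rightarrow> ('a + 'a set) ugraph" where
  "middle_graph G = \<lparr>
     verts = Inl ` verts G \<union> Inr ` edges G,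
     edges = {{Inr e, Inr f} | e f. e \<in> edges G \<and> f \<in> edges G \<and> e \<noteq> f \<and> e \<inter> f \<noteq> {}}
           \<union> {{Inl v, Inr e} | v e. v \<in> verts G \<and> e \<in> edges G \<and> v \<in> e} \<rparr>"

definition total_dominating_set :: "'a ugraph \<Rightarrow> 'a set \<Rightarrow> bool" where
  "total_dominating_set H S \<longleftrightarrow> S \<subseteq> verts H \<and> (\<forall>v \<in> verts H. \<exists>u \<in> S. adjacent H v u)"

text \<open>Meaningful only for a finite graph without isolated vertices: otherwise there is no
  total dominating set and the value is unspecified.\<close>

definition total_domination_number :: "'a ugraph \<Rightarrow> nat" where
  "total_domination_number H = (LEAST k. \<exists>S. total_dominating_set H S \<and> card S = k)"

lemma simple_graph_two_corona:
  assumes "simple_graph G"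
  shows "simple_graph (two_corona G)"
proof -
  have "\<exists>x \<in> verts (two_corona G). \<exists>y \<in> verts (two_corona G). x \<noteq> y \<and> e = {x, y}"
    if e: "e \<in> edges (two_corona G)" for e
  proof -
    consider u v where "e = {Orig u, Orig v}" "{u, v} \<in> edges G"
      | v where "e = {Orig v, PathA v}" "v \<in> verts G"
      | v where "e = {PathA v, PathB v}" "v \<in> verts G"
      using e unfolding two_corona_def by auto
    then show ?thesis
    proof cases
      case 1
      then have "u \<in> verts G" "v \<in> verts G" "u \<noteq> v"
        using assms unfolding simple_graph_def by (metis doubleton_eq_iff)+
      then show ?thesis using 1
        by (intro bexI[of _ "Orig u"] bexI[of _ "Orig v"]) (auto simp: two_corona_def)
    qed (auto simp: two_corona_def)
  qed
  moreover have "finite (verts (two_corona G))"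
    using assms by (simp add: simple_graph_def two_corona_def)
  ultimately show ?thesis by (simp add: simple_graph_def)
qed

lemma card_verts_two_corona:
  assumes "finite (verts G)"
  shows "card (verts (two_corona G)) = 3 * card (verts G)"
proof -
  have "(Orig ` verts G \<union> PathA ` verts G) \<inter> PathB ` verts G = {}"
    "Orig ` verts G \<inter> PathA ` verts G = {}" by auto
  then have "card (Orig ` verts G \<union> PathA ` verts G \<union> PathB ` verts G)
      = card (Orig ` verts G) + card (PathA ` verts G) + card (PathB ` verts G)"
    using assms by (simp only: card_Un_disjoint finite_Un finite_imageI)
  then show ?thesis by (simp add: two_corona_def card_image inj_on_def)
qed

lemma simple_graph_middle_graph:
  assumes "simple_graph G"
  shows "simple_graph (middle_graph G)"
proof -
  have "edges G \<subseteq> Pow (verts G)" using assms by (auto simp: simple_graph_def)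
  then have "finite (edges G)"
    using assms finite_subset by (auto simp: simple_graph_def)
  moreover have "\<exists>x \<in> verts (middle_graph G). \<exists>y \<in> verts (middle_graph G). x \<noteq> y \<and> e = {x, y}"
    if e: "e \<in> edges (middle_graph G)" for e
  proof -
    consider a b where "e = {Inr a, Inr b}" "a \<in> edges G" "b \<in> edges G" "a \<noteq> b"
      | v a where "e = {Inl v, Inr a}" "v \<in> verts G" "a \<in> edges G"
      using e unfolding middle_graph_def by auto
    then show ?thesis
    proof cases
      case 1
      then show ?thesis
        by (intro bexI[of _ "Inr a"] bexI[of _ "Inr b"]) (auto simp: middle_graph_def)
    qed (auto simp: middle_graph_def)
  qed
  ultimately show ?thesis using assms by (simp add: simple_graph_def middle_graph_def)
qed

text \<open>The total domination number of the middle graph of a 2-corona is well defined.\<close>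

lemma ex_total_dominating_set_middle_two_corona:
  "\<exists>S. total_dominating_set (middle_graph (two_corona G)) S" if "simple_graph G"
proof
  let ?C = "two_corona G"
  let ?M = "middle_graph ?C"
  have inc: "\<exists>v \<in> verts ?C. v \<in> e" if "e \<in> edges ?C" for e
    using simple_graph_two_corona[OF \<open>simple_graph G\<close>] that by (auto simp: simple_graph_def)
  have cov: "\<exists>e \<in> edges ?C. v \<in> e" if "v \<in> verts ?C" for v
    using that by (auto simp: two_corona_def)
  have "\<exists>y \<in> verts ?M. adjacent ?M x y" if x: "x \<in> verts ?M" for x
  proof (cases x)
    case (Inl v)
    then have "v \<in> verts ?C" using x by (auto simp: middle_graph_def)
    then obtain e where "e \<in> edges ?C" "v \<in> e" using cov by blast
    then show ?thesis using Inl \<open>v \<in> verts ?C\<close>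
      by (intro bexI[of _ "Inr e"]) (auto simp: middle_graph_def adjacent_def)
  next
    case (Inr e)
    then have "e \<in> edges ?C" using x by (auto simp: middle_graph_def)
    then obtain v where "v \<in> verts ?C" "v \<in> e" using inc by blast
    then have "{Inl v, Inr e} \<in> edges ?M" using \<open>e \<in> edges ?C\<close>
      by (auto simp: middle_graph_def)
    then show ?thesis using Inr \<open>v \<in> verts ?C\<close>
      by (intro bexI[of _ "Inl v"]) (auto simp: middle_graph_def adjacent_def insert_commute)
  qed
  then show "total_dominating_set ?M (verts ?M)" by (simp add: total_dominating_set_def)
qed

end

theory Submission
  imports Defs
begin

text \<open>In the middle graph of the corona, the leaf \<open>b\<^sub>v\<close> has the single neighbour \<open>a\<^sub>v b\<^sub>v\<close>, so this
  edge lies in every total dominating set, together with a neighbour of its own, which is one of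
  \<open>a\<^sub>v\<close>, \<open>b\<^sub>v\<close>, \<open>v a\<^sub>v\<close>. These \<open>2n\<close> elements are distinct. Conversely, the edges \<open>v a\<^sub>v\<close> and
  \<open>a\<^sub>v b\<^sub>v\<close> form a total dominating set.\<close>

lemma adjacent_middle_graph_simps [simp]:
  "\<not> adjacent (middle_graph G) (Inl u) (Inl v)"
  "adjacent (middle_graph G) (Inl v) (Inr e) \<longleftrightarrow> v \<in> verts G \<and> e \<in> edges G \<and> v \<in> e"
  "adjacent (middle_graph G) (Inr e) (Inl v) \<longleftrightarrow> v \<in> verts G \<and> e \<in> edges G \<and> v \<in> e"
  "adjacent (middle_graph G) (Inr e) (Inr f) \<longleftrightarrow>
     e \<in> edges G \<and> f \<in> edges G \<and> e \<noteq> f \<and> e \<inter> f \<noteq> {}"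
  by (auto simp: adjacent_def middle_graph_def doubleton_eq_iff)

lemma verts_middle_graph: "verts (middle_graph G) = Inl ` verts G \<union> Inr ` edges G"
  by (simp add: middle_graph_def)

lemma two_corona_edge_cases:
  assumes "e \<in> edges (two_corona G)"
  obtains (orig) u v where "{u, v} \<in> edges G" "e = {Orig u, Orig v}"
    | (inner) v where "v \<in> verts G" "e = {Orig v, PathA v}"
    | (outer) v where "v \<in> verts G" "e = {PathA v, PathB v}"
  using assms by (auto simp: two_corona_def)

lemma two_corona_edgesI:
  assumes "v \<in> verts G"
  shows "{Orig v, PathA v} \<in> edges (two_corona G)" "{PathA v, PathB v} \<in> edges (two_corona G)"
  using assms by (auto simp: two_corona_def)

text \<open>\<open>PathB v\<close> lies on only one edge of the corona, and a vertex is adjacent in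
  the middle graph only to edges through it.\<close>

lemma adjacent_middle_two_corona_PathB:
  assumes "adjacent (middle_graph (two_corona G)) (Inl (PathB v)) x"
  shows "x = Inr {PathA v, PathB v}"
  using assms by (cases x) (auto elim!: two_corona_edge_cases)

text \<open>Besides its two endpoints, only edges meeting the outer edge qualify, and the inner edge
  at \<open>v\<close> is the only other corona edge through \<open>PathA v\<close> or
  \<open>PathB v\<close>.\<close>

lemma adjacent_middle_two_corona_outer_edge:
  assumes "adjacent (middle_graph (two_corona G)) (Inr {PathA v, PathB v}) x"
  shows "x \<in> {Inl (PathA v), Inl (PathB v), Inr {Orig v, PathA v}}"
  using assms by (cases x) (auto elim!: two_corona_edge_cases)

text \<open>The lower bound. Finiteness of \<open>S\<close> is assumed because \<open>card\<close>
  is 0 on infinite sets.\<close>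

lemma total_dominating_set_middle_two_corona_card_ge:
  assumes "finite (verts G)" and "finite S"
    and S: "total_dominating_set (middle_graph (two_corona G)) S"
  shows "2 * card (verts G) \<le> card S"
proof -
  let ?M = "middle_graph (two_corona G)"
  define p :: "'a \<Rightarrow> 'a corona_vertex + 'a corona_vertex set"
    where "p v = Inr {PathA v, PathB v}" for v
  have dom: "\<exists>u \<in> S. adjacent ?M x u" if "x \<in> verts ?M" for x
    using S that by (simp add: total_dominating_set_def)
  have p: "p v \<in> S" if "v \<in> verts G" for v
  proof -
    have "Inl (PathB v) \<in> verts ?M"
      using that by (simp add: verts_middle_graph two_corona_def)
    then obtain x where "x \<in> S" "adjacent ?M (Inl (PathB v)) x"
      using dom by blast
    then show ?thesis
      using adjacent_middle_two_corona_PathB by (metis p_def)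
  qed
  \<comment> \<open>Domination is total, so \<open>p v\<close> needs a neighbour in \<open>S\<close>
    although it is itself in \<open>S\<close>.\<close>
  have "\<exists>x \<in> S. adjacent ?M (p v) x" if "v \<in> verts G" for v
    using that by (intro dom) (auto simp: p_def verts_middle_graph intro: two_corona_edgesI)
  then obtain q where q: "\<And>v. v \<in> verts G \<Longrightarrow> q v \<in> S \<and> adjacent ?M (p v) (q v)"
    by metis
  have q_cases: "q v \<in> {Inl (PathA v), Inl (PathB v), Inr {Orig v, PathA v}}"
    if "v \<in> verts G" for v
    using q[OF that] by (intro adjacent_middle_two_corona_outer_edge[of G]) (simp add: p_def)
  have "inj_on p (verts G)"
    by (auto simp: p_def inj_on_def doubleton_eq_iff)
  \<comment> \<open>Each of the three candidates for \<open>q v\<close> determines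
    \<open>v\<close>.\<close>
  moreover have "inj_on q (verts G)"
  proof (rule inj_onI)
    fix u v assume "u \<in> verts G" "v \<in> verts G" "q u = q v"
    then show "u = v"
      using q_cases[of u] q_cases[of v] by (auto simp: doubleton_eq_iff)
  qed
  \<comment> \<open>No candidate for \<open>q v\<close> is an outer edge.\<close>
  moreover have "p ` verts G \<inter> q ` verts G = {}"
    using q_cases by (force simp: p_def doubleton_eq_iff)
  ultimately have "card (p ` verts G \<union> q ` verts G) = 2 * card (verts G)"
    using assms(1) by (simp add: card_Un_disjoint card_image)
  moreover have "p ` verts G \<union> q ` verts G \<subseteq> S"
    using p q by blast
  ultimately show ?thesis
    using \<open>finite S\<close> card_mono by metis
qed

text \<open>The upper bound, witnessed by all edges of the attached paths.\<close>

lemma total_dominating_set_middle_two_corona_ex: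
  assumes "simple_graph G"
  shows "\<exists>S. total_dominating_set (middle_graph (two_corona G)) S \<and> card S = 2 * card (verts G)"
proof -
  let ?M = "middle_graph (two_corona G)"
  define p q :: "'a \<Rightarrow> 'a corona_vertex + 'a corona_vertex set"
    where "p v = Inr {PathA v, PathB v}" and "q v = Inr {Orig v, PathA v}" for v
  define S where "S = p ` verts G \<union> q ` verts G"
  have fin: "finite (verts G)"
    using assms by (simp add: simple_graph_def)
  have "inj_on p (verts G)" "inj_on q (verts G)" "p ` verts G \<inter> q ` verts G = {}"
    by (auto simp: p_def q_def inj_on_def doubleton_eq_iff)
  then have "card S = 2 * card (verts G)"
    using fin by (simp add: S_def card_Un_disjoint card_image)
  moreover have "S \<subseteq> verts ?M"
    by (auto simp: S_def p_def q_def verts_middle_graph intro: two_corona_edgesI)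
  moreover have "\<exists>y \<in> S. adjacent ?M x y" if x: "x \<in> verts ?M" for x
  proof (cases x)
    case (Inl w)
    then have w: "w \<in> verts (two_corona G)"
      using x by (auto simp: verts_middle_graph)
    then consider v where "v \<in> verts G" "w = Orig v" | v where "v \<in> verts G" "w \<in> {PathA v, PathB v}"
      by (auto simp: two_corona_def)
    then show ?thesis
    proof cases
      case 1
      then have "adjacent ?M x (q v)"
        using Inl w by (simp add: q_def two_corona_edgesI)
      then show ?thesis using 1 by (auto simp: S_def)
    next
      case 2
      then have "adjacent ?M x (p v)"
        using Inl w by (simp add: p_def two_corona_edgesI)
      then show ?thesis using 2 by (auto simp: S_def)
    qed
  next
    case (Inr e)
    then have e: "e \<in> edges (two_corona G)"
      using x by (auto simp: verts_middle_graph)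
    then show ?thesis
    proof (cases rule: two_corona_edge_cases)
      case (orig u v)
      then have u: "u \<in> verts G"
        using assms unfolding simple_graph_def by (metis doubleton_eq_iff)
      \<comment> \<open>The copied edge and the inner edge at \<open>u\<close> share
        \<open>Orig u\<close>; they differ in \<open>PathA u\<close>.\<close>
      have "adjacent ?M x (q u)"
        using Inr e orig u by (auto simp: q_def two_corona_edgesI doubleton_eq_iff)
      then show ?thesis using u by (auto simp: S_def)
    next
      case (inner v)
      \<comment> \<open>The inner and outer edges at \<open>v\<close> meet in
        \<open>PathA v\<close>, so each dominates the other.\<close>
      then have "adjacent ?M x (p v)"
        using Inr e by (auto simp: p_def two_corona_edgesI doubleton_eq_iff)
      then show ?thesis using inner by (auto simp: S_def)
    next
      case (outer v)
      then have "adjacent ?M x (q v)"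
        using Inr e by (auto simp: q_def two_corona_edgesI doubleton_eq_iff)
      then show ?thesis using outer by (auto simp: S_def)
    qed
  qed
  ultimately show ?thesis
    unfolding total_dominating_set_def by blast
qed

theorem theorem4p6:
  fixes G :: "'a ugraph" and n :: nat
  assumes "simple_graph G"
    and "connected_graph G"
    and "card (verts G) = n"
    and "n \<ge> 2"
  shows "total_domination_number (middle_graph (two_corona G)) = 2 * n"
  unfolding total_domination_number_def
proof (rule Least_equality)
  let ?M = "middle_graph (two_corona G)"
  show "\<exists>S. total_dominating_set ?M S \<and> card S = 2 * n"
    using total_dominating_set_middle_two_corona_ex[OF assms(1)] assms(3) by simp
  fix k assume "\<exists>S. total_dominating_set ?M S \<and> card S = k"
  then obtain S where S: "total_dominating_set ?M S" "card S = k"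
    by blast
  \<comment> \<open>A finite middle graph makes every competing \<open>S\<close> finite, as the
    lower bound requires.\<close>
  have "finite (verts ?M)" "finite (verts G)"
    using assms(1) simple_graph_middle_graph[OF simple_graph_two_corona[OF assms(1)]]
    by (simp_all add: simple_graph_def)
  moreover from this S have "finite S"
    using finite_subset by (auto simp: total_dominating_set_def)
  ultimately show "2 * n \<le> k"
    using total_dominating_set_middle_two_corona_card_ge S assms(3) by metis
qed

end
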